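(* Let $G$ be a finite, simple and connected digraph, let $\Sigma=\{h_1,\dots,h_n\}$ be the set of all simple cycles of the line digraph without backtracks $L_{WB}(G)$, let $\mathcal{H}=\Sigma^*/I_{\mathcal{H}}$ be the hike monoid with commutation graph $G(\mathcal{H})$, and let $\tilde{G}_+(\mathcal{H})$ be a closure of the noncommutation graph $\tilde{G}(\mathcal{H})$ with adjacency matrix $A(\tilde{G}_+(\mathcal{H}))$. Let $D(\tilde{G}_+(\mathcal{H}))=\mathrm{diag}[h_1,\dots,h_n]\in M_n(\mathbb{Z}\langle\mathcal{H}\rangle)$, and let $p_{\mathcal{H}}(G(\mathcal{H}))$ be the clique polynomial on $\mathbb{Z}\langle\mathcal{H}\rangle$. Then, in $\mathbb{Z}\langle\mathcal{H}\rangle$, $$\mathrm{Cdet}\bigl(I_n-D(\tilde{G}_+(\mathcal{H}))\,A(\tilde{G}_+(\mathcal{H}))\bigr)=p_{\mathcal{H}}(G(\mathcal{H})).$$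
   Context: Digraphs: directed edges $e=(u,v)$ have origin $o(e)=u$ and terminus $t(e)=v$. A digraph is simple if it has no directed loops and no multiple directed edges, connected if its underlying undirected graph is connected. If $e=(u,v)$ and $(v,u)$ are both edges, $e^{-1}=(v,u)$; if $(v,u)$ is not an edge, the condition $e^{-1}\neq f$ holds for every $f$. $L_{WB}(G)$ is the digraph with vertex set $E(G)$ and edge set $\{(e,f): t(e)=o(f),\ e^{-1}\neq f\}$. A cycle is a closed directed path $(e_1,\dots,e_m)$, $m\ge1$; it is simple if the origins $o(e_1),\dots,o(e_m)$ are distinct. Hike monoid: $\Sigma$ is the (finite) set of simple cycles of $L_{WB}(G)$, up to cyclic rotation, with a fixed indexing $h_1,\dots,h_n$. $V(h)$ is the set of vertices of $L_{WB}(G)$ visited by $h$. $\mathcal{H}=\Sigma^*/I_{\mathcal{H}}$ is the quotient of the free monoid $\Sigma^*$ by the congruence generated by $h_ih_j=h_jh_i$ for $(h_i,h_j)\in I_{\mathcal{H}}$, where $(h_i,h_j)\in I_{\mathcal{H}}\iff V(h_i)\cap V(h_j)=\emptyset$. $\mathbb{Z}\langle\mathcal{H}\rangle$ is the monoid ring of $\mathcal{H}$ over $\mathbb{Z}$. The commutation graph $G(\mathcal{H})$ has vertex set $\Sigma$ and edges $\{h_i,h_j\}$ for $(h_i,h_j)\in I_{\mathcal{H}}$; the noncommutation graph $\tilde{G}(\mathcal{H})$ has vertex set $\Sigma$ and edges $\{h_i,h_j\}$ for $(h_i,h_j)\notin I_{\mathcal{H}}$ (so it has a loop at each vertex). Clique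 polynomial: $p_{\mathcal{H}}(G(\mathcal{H}))=\sum_{c}(-1)^{\#c}\prod_{h\in c}h\in\mathbb{Z}\langle\mathcal{H}\rangle$, the sum over all cliques $c$ of $G(\mathcal{H})$ (sets of pairwise adjacent vertices, including the empty clique, which contributes $1$); the product is well defined since elements of a clique commute pairwise. Cayley determinant: for a matrix $X=(x_{i,j})\in M_n(R)$ over a possibly noncommutative ring $R$, $\mathrm{Cdet}(X)=\sum_{\sigma\in S_n}\mathrm{sgn}(\sigma)\,x_{1,\sigma(1)}x_{2,\sigma(2)}\cdots x_{n,\sigma(n)}$ (product in increasing order of row index). Closure: a closure of $\tilde{G}(\mathcal{H})$ is a digraph $\tilde{G}_+(\mathcal{H})=(\Sigma,E)$ such that: (a) $(h_i,h_i)\in E$ for every $i$; (b) if $i\neq j$ and $\{h_i,h_j\}\in E(\tilde{G}(\mathcal{H}))$ then both $(h_i,h_j),(h_j,h_i)\in E$; (c) if $i\neq j$ and $\{h_i,h_j\}\notin E(\tilde{G}(\mathcal{H}))$ then exactly one of $(h_i,h_j),(h_j,h_i)$ is in $E$; and for every triple of distinct vertices $h_s,h_t,h_u$: (1) if $\{h_s,h_t\}\in E(\tilde{G}(\mathcal{H}))$ but $\{h_s,h_u\},\{h_t,h_u\}\notin E(\tilde{G}(\mathcal{H}))$, then either $(h_s,h_u),(h_t,h_u)\in E$ or $(h_u,h_s),(h_u,h_t)\in E$; (2) if none of the three pairs is an edge of $\tilde{G}(\mathcal{H})$, then the orientation on the triple is not a directed $3$-cycle. A closure need not exist; the statement concerns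 any closure when one exists. The adjacency matrix has $(i,j)$ entry $1$ if $(h_i,h_j)\in E$ and $0$ otherwise. *)

theory Defs
  imports
    "Graph_Theory.Graph_Theory"
    "HOL-Algebra.Ring"
    "HOL-Library.Poly_Mapping"
    "HOL-Combinatorics.Permutations"
begin

section \<open>Undirected graphs\<close>

text \<open>A graph is a vertex set with a set of edges; a loop at \<open>x\<close> is the edge \<open>{x}\<close>.\<close>

type_synonym 'a ugraph = "'a set \<times> 'a set set"

definition cliques :: "'a ugraph \<Rightarrow> 'a set set" where
  "cliques U = {c. c \<subseteq> fst U \<and> (\<forall>x\<in>c. \<forall>y\<in>c. x \<noteq> y \<longrightarrow> {x, y} \<in> snd U)}"

definition is_closure :: "'a ugraph \<Rightarrow> 'a pair_pre_digraph \<Rightarrow> bool" where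
  "is_closure U D \<longleftrightarrow>
     (let V = fst U; W = snd U; E = parcs D in
       pverts D = V \<and> E \<subseteq> V \<times> V \<and>
       (\<forall>x\<in>V. (x, x) \<in> E) \<and>
       (\<forall>x\<in>V. \<forall>y\<in>V. x \<noteq> y \<longrightarrow> {x, y} \<in> W \<longrightarrow> (x, y) \<in> E \<and> (y, x) \<in> E) \<and>
       (\<forall>x\<in>V. \<forall>y\<in>V. x \<noteq> y \<longrightarrow> {x, y} \<notin> W \<longrightarrow>
          ((x, y) \<in> E \<and> (y, x) \<notin> E) \<or> ((x, y) \<notin> E \<and> (y, x) \<in> E)) \<and>
       (\<forall>s\<in>V. \<forall>t\<in>V. \<forall>u\<in>V. s \<noteq> t \<longrightarrow> s \<noteq> u \<longrightarrow> t \<noteq> u \<longrightarrow>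
          {s, t} \<in> W \<longrightarrow> {s, u} \<notin> W \<longrightarrow> {t, u} \<notin> W \<longrightarrow>
          ((s, u) \<in> E \<and> (t, u) \<in> E) \<or> ((u, s) \<in> E \<and> (u, t) \<in> E)) \<and>
       (\<forall>s\<in>V. \<forall>t\<in>V. \<forall>u\<in>V. s \<noteq> t \<longrightarrow> s \<noteq> u \<longrightarrow> t \<noteq> u \<longrightarrow>
          {s, t} \<notin> W \<longrightarrow> {s, u} \<notin> W \<longrightarrow> {t, u} \<notin> W \<longrightarrow>
          \<not> ((s, t) \<in> E \<and> (t, u) \<in> E \<and> (u, s) \<in> E) \<and>
          \<not> ((s, u) \<in> E \<and> (u, t) \<in> E \<and> (t, s) \<in> E)))"


section \<open>Partially commutative monoids and monoid rings over the integers\<close>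

text \<open>The congruence on words over \<open>S\<close> generated by \<open>ab = ba\<close> for \<open>(a, b) \<in> I\<close>.\<close>

inductive_set trace_cong :: "'a set \<Rightarrow> ('a \<times> 'a) set \<Rightarrow> ('a list \<times> 'a list) set"
  for S :: "'a set" and I :: "('a \<times> 'a) set" where
  swap: "a \<in> S \<Longrightarrow> b \<in> S \<Longrightarrow> (a, b) \<in> I \<Longrightarrow> ([a, b], [b, a]) \<in> trace_cong S I"
| refl: "w \<in> lists S \<Longrightarrow> (w, w) \<in> trace_cong S I"
| sym: "(v, w) \<in> trace_cong S I \<Longrightarrow> (w, v) \<in> trace_cong S I"
| trans: "(u, v) \<in> trace_cong S I \<Longrightarrow> (v, w) \<in> trace_cong S I \<Longrightarrow> (u, w) \<in> trace_cong S I"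
| append: "(u, u') \<in> trace_cong S I \<Longrightarrow> (v, v') \<in> trace_cong S I \<Longrightarrow>
    (u @ v, u' @ v') \<in> trace_cong S I"

definition trace_class :: "'a set \<Rightarrow> ('a \<times> 'a) set \<Rightarrow> 'a list \<Rightarrow> 'a list set" where
  "trace_class S I w = trace_cong S I `` {w}"

definition trace_monoid :: "'a set \<Rightarrow> ('a \<times> 'a) set \<Rightarrow> 'a list set monoid" where
  "trace_monoid S I =
     \<lparr>carrier = lists S // trace_cong S I,
      monoid.mult = (\<lambda>X Y. \<Union>u\<in>X. \<Union>v\<in>Y. trace_class S I (u @ v)),
      one = trace_class S I []\<rparr>"

definition int_monoid_ring :: "('m, 'b) monoid_scheme \<Rightarrow> ('m \<Rightarrow>\<^sub>0 int) ring" where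
  "int_monoid_ring M =
     \<lparr>carrier = {f. Poly_Mapping.keys f \<subseteq> carrier M},
      monoid.mult = (\<lambda>f g. \<Sum>x\<in>Poly_Mapping.keys f. \<Sum>y\<in>Poly_Mapping.keys g.
         Poly_Mapping.single (x \<otimes>\<^bsub>M\<^esub> y) (Poly_Mapping.lookup f x * Poly_Mapping.lookup g y)),
      one = Poly_Mapping.single \<one>\<^bsub>M\<^esub> 1,
      zero = 0,
      add = (+)\<rparr>"


section \<open>Matrices and the Cayley determinant over a noncommutative ring\<close>

text \<open>Matrices are functions whose rows and columns are indexed by \<open>{1..n}\<close>.\<close>

type_synonym 'r matrix = "nat \<Rightarrow> nat \<Rightarrow> 'r"

definition one_matrix :: "('r, 'b) ring_scheme \<Rightarrow> 'r matrix" where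
  "one_matrix R = (\<lambda>i j. if i = j then \<one>\<^bsub>R\<^esub> else \<zero>\<^bsub>R\<^esub>)"

definition diag_matrix :: "('r, 'b) ring_scheme \<Rightarrow> (nat \<Rightarrow> 'r) \<Rightarrow> 'r matrix" where
  "diag_matrix R d = (\<lambda>i j. if i = j then d i else \<zero>\<^bsub>R\<^esub>)"

definition adjacency_matrix ::
    "('r, 'b) ring_scheme \<Rightarrow> (nat \<Rightarrow> 'a) \<Rightarrow> 'a pair_pre_digraph \<Rightarrow> 'r matrix" where
  "adjacency_matrix R h D = (\<lambda>i j. if (h i, h j) \<in> parcs D then \<one>\<^bsub>R\<^esub> else \<zero>\<^bsub>R\<^esub>)"

definition matrix_minus :: "('r, 'b) ring_scheme \<Rightarrow> 'r matrix \<Rightarrow> 'r matrix \<Rightarrow> 'r matrix" where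
  "matrix_minus R X Y = (\<lambda>i j. X i j \<ominus>\<^bsub>R\<^esub> Y i j)"

definition matrix_mult ::
    "('r, 'b) ring_scheme \<Rightarrow> nat \<Rightarrow> 'r matrix \<Rightarrow> 'r matrix \<Rightarrow> 'r matrix" where
  "matrix_mult R n X Y = (\<lambda>i j. \<Oplus>\<^bsub>R\<^esub>k\<in>{1..n}. X i k \<otimes>\<^bsub>R\<^esub> Y k j)"

definition ring_list_prod :: "('r, 'b) ring_scheme \<Rightarrow> 'r list \<Rightarrow> 'r" where
  "ring_list_prod R xs = foldr (\<lambda>x y. x \<otimes>\<^bsub>R\<^esub> y) xs \<one>\<^bsub>R\<^esub>"

definition Cdet :: "('r, 'b) ring_scheme \<Rightarrow> nat \<Rightarrow> 'r matrix \<Rightarrow> 'r" where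
  "Cdet R n X = (\<Oplus>\<^bsub>R\<^esub>\<sigma>\<in>{\<sigma>. \<sigma> permutes {1..n}}.
     [sign \<sigma>] \<cdot>\<^bsub>R\<^esub> ring_list_prod R (map (\<lambda>i. X i (\<sigma> i)) [1..<Suc n]))"


section \<open>Clique polynomials\<close>

text \<open>
  The product over a finite set \<open>c\<close> whose factors commute pairwise; the enumeration of \<open>c\<close> that
  is chosen does not matter then.
\<close>

definition commuting_prod :: "('r, 'b) ring_scheme \<Rightarrow> ('a \<Rightarrow> 'r) \<Rightarrow> 'a set \<Rightarrow> 'r" where
  "commuting_prod R f c = ring_list_prod R (map f (SOME xs. distinct xs \<and> set xs = c))"

definition clique_polynomial ::
    "('r, 'b) ring_scheme \<Rightarrow> ('a \<Rightarrow> 'r) \<Rightarrow> 'a ugraph \<Rightarrow> 'r" where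
  "clique_polynomial R f U =
     (\<Oplus>\<^bsub>R\<^esub>c\<in>cliques U. [((- 1 :: int) ^ card c)] \<cdot>\<^bsub>R\<^esub> commuting_prod R f c)"


section \<open>Line digraphs without backtracks and the hike monoid\<close>

text \<open>
  If \<open>prod.swap e\<close> is not an edge, then it differs from every edge \<open>f\<close>, so the condition
  \<open>prod.swap e \<noteq> f\<close> is vacuous in that case, as it should be.
\<close>

definition line_digraph_wb :: "'v pair_pre_digraph \<Rightarrow> ('v \<times> 'v) pair_pre_digraph" where
  "line_digraph_wb G =
     \<lparr>pverts = parcs G,
      parcs = {(e, f). e \<in> parcs G \<and> f \<in> parcs G \<and> snd e = fst f \<and> prod.swap e \<noteq> f}\<rparr>"

definition simple_cycle :: "'w pair_pre_digraph \<Rightarrow> ('w \<times> 'w) list \<Rightarrow> bool" where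
  "simple_cycle L p \<longleftrightarrow>
     p \<noteq> [] \<and> (\<exists>u. pre_digraph.awalk (with_proj L) u p u) \<and> distinct (map fst p)"

definition rotation_rel :: "'w pair_pre_digraph \<Rightarrow> (('w \<times> 'w) list \<times> ('w \<times> 'w) list) set" where
  "rotation_rel L = {(p, q). simple_cycle L p \<and> simple_cycle L q \<and> (\<exists>k. q = rotate k p)}"

text \<open>A cycle up to cyclic rotation is the set of its rotations.\<close>

type_synonym 'w cyclic_path = "('w \<times> 'w) list set"

definition simple_cycles :: "'w pair_pre_digraph \<Rightarrow> 'w cyclic_path set" where
  "simple_cycles L = {p. simple_cycle L p} // rotation_rel L"

definition visited :: "'w cyclic_path \<Rightarrow> 'w set" where
  "visited h = (\<Union>p\<in>h. set (map fst p))"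

definition hikes_alphabet :: "'v pair_pre_digraph \<Rightarrow> ('v \<times> 'v) cyclic_path set" where
  "hikes_alphabet G = simple_cycles (line_digraph_wb G)"

definition hikes_independence ::
    "'v pair_pre_digraph \<Rightarrow> (('v \<times> 'v) cyclic_path \<times> ('v \<times> 'v) cyclic_path) set" where
  "hikes_independence G =
     {(h, k). h \<in> hikes_alphabet G \<and> k \<in> hikes_alphabet G \<and> visited h \<inter> visited k = {}}"

definition hike_monoid :: "'v pair_pre_digraph \<Rightarrow> ('v \<times> 'v) cyclic_path list set monoid" where
  "hike_monoid G = trace_monoid (hikes_alphabet G) (hikes_independence G)"

definition hike_ring :: "'v pair_pre_digraph \<Rightarrow> (('v \<times> 'v) cyclic_path list set \<Rightarrow>\<^sub>0 int) ring" where
  "hike_ring G = int_monoid_ring (hike_monoid G)"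

text \<open>The image of a simple cycle in the monoid ring.\<close>

definition hike_gen ::
    "'v pair_pre_digraph \<Rightarrow> ('v \<times> 'v) cyclic_path \<Rightarrow> (('v \<times> 'v) cyclic_path list set \<Rightarrow>\<^sub>0 int)" where
  "hike_gen G h =
     Poly_Mapping.single (trace_class (hikes_alphabet G) (hikes_independence G) [h]) 1"

definition commutation_graph :: "'v pair_pre_digraph \<Rightarrow> ('v \<times> 'v) cyclic_path ugraph" where
  "commutation_graph G =
     (hikes_alphabet G, {{h, k} | h k. (h, k) \<in> hikes_independence G})"

definition noncommutation_graph :: "'v pair_pre_digraph \<Rightarrow> ('v \<times> 'v) cyclic_path ugraph" where
  "noncommutation_graph G =
     (hikes_alphabet G,
      {{h, k} | h k. h \<in> hikes_alphabet G \<and> k \<in> hikes_alphabet G \<and>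
         (h, k) \<notin> hikes_independence G})"

end

theory Submission
  imports Defs
begin

text \<open>
  Conditions (1) and (2) on a closure say that its non-edges, reversed, form a strict partial order
  whose comparability graph is the commutation graph. Expanding each row of \<open>I - D A\<close> as a unit
  vector minus \<open>h\<^sub>i\<close> times a row of \<open>A\<close> turns the Cayley determinant into the sum over all sets \<open>T\<close> of
  cycles of \<open>(-1)\<^bsup>card T\<^esup>\<close> times the integer determinant of the principal submatrix of \<open>A\<close> on
  \<open>T\<close> times the ordered product of \<open>T\<close>. That integer determinant is 1 if \<open>T\<close> is a chain of the
  order, i.e. a clique of the commutation graph, and 0 otherwise.
\<close>

section \<open>Integer determinants of partial orders\<close>

text \<open>Indexing by a set makes every principal submatrix a mere restriction of
  \<open>S\<close>, with no renumbering; the empty submatrix has determinant 1.\<close>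

definition leibniz_det :: "'a set \<Rightarrow> ('a \<Rightarrow> 'a \<Rightarrow> int) \<Rightarrow> int" where
  "leibniz_det S B = (\<Sum>p | p permutes S. sign p * (\<Prod>i\<in>S. B i (p i)))"

text \<open>Precomposition with the transposition of \<open>a\<close> and \<open>b\<close> permutes
  the Leibniz terms and flips each sign, so the determinant equals its own negative, which over the
  integers forces 0.\<close>

lemma leibniz_det_identical_rows:
  assumes "finite S" "a \<in> S" "b \<in> S" "a \<noteq> b" "\<And>j. j \<in> S \<Longrightarrow> B a j = B b j"
  shows "leibniz_det S B = 0"
proof -
  define q where "q = transpose a b"
  have q: "q permutes S"
    unfolding q_def using assms by (intro permutes_swap_id) auto
  have "sign (p \<circ> q) * (\<Prod>i\<in>S. B i ((p \<circ> q) i)) = - (sign p * (\<Prod>i\<in>S. B i (p i)))"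
    if p: "p permutes S" for p
  proof -
    have "sign (p \<circ> q) = - sign p"
      using p q \<open>finite S\<close> \<open>a \<noteq> b\<close> sign_compose[of p q]
      by (auto simp: permutation_permutes q_def sign_swap_id)
    \<comment> \<open>Only the factors at \<open>a\<close> and \<open>b\<close> change their row,
      and these two rows agree; reindexing by \<open>q\<close> then restores the original
      product.\<close>
    moreover have "(\<Prod>i\<in>S. B i ((p \<circ> q) i)) = (\<Prod>i\<in>S. B (q i) (p (q i)))"
    proof (rule prod.cong)
      fix i assume "i \<in> S"
      hence "p (q i) \<in> S" using p q by (simp add: permutes_in_image)
      thus "B i ((p \<circ> q) i) = B (q i) (p (q i))"
        using assms by (cases "i = a \<or> i = b") (auto simp: q_def)
    qed simp
    moreover have "\<dots> = (\<Prod>i\<in>S. B i (p i))"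
      by (rule prod.permute[OF q, symmetric, unfolded o_def])
    ultimately show ?thesis by simp
  qed
  hence "leibniz_det S B = - leibniz_det S B"
    unfolding leibniz_det_def
    by (subst (1) sum_permutations_compose_right[OF q]) (simp add: sum_negf)
  thus ?thesis by simp
qed

text \<open>Laplace expansion along a unit column: a nonzero term has to meet column
  \<open>m\<close> in row \<open>m\<close>, so its permutation fixes \<open>m\<close> and lives on
  the remaining indices.\<close>

lemma leibniz_det_unit_column:
  assumes "finite S" "m \<in> S" "B m m = 1" "\<And>i. i \<in> S \<Longrightarrow> i \<noteq> m \<Longrightarrow> B i m = 0"
  shows "leibniz_det S B = leibniz_det (S - {m}) B"
proof -
  have vanish: "(\<Prod>i\<in>S. B i (p i)) = 0"
    if p: "p permutes S" and np: "\<not> p permutes (S - {m})" for p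
  proof -
    have "p m \<noteq> m"
      using p np permutes_superset[of p S "S - {m}"] by auto
    \<comment> \<open>The row that \<open>p\<close> sends to column \<open>m\<close>; it is not
      \<open>m\<close>, so it contributes a zero factor.\<close>
    define i where "i = inv_into UNIV p m"
    have "p i = m" unfolding i_def using p by (simp add: permutes_inverses)
    moreover have "i \<in> S"
      unfolding i_def using \<open>m \<in> S\<close> permutes_in_image[OF permutes_inv[OF p]] by blast
    moreover have "i \<noteq> m" using \<open>p m \<noteq> m\<close> \<open>p i = m\<close> by force
    ultimately have "\<exists>i\<in>S. B i (p i) = 0"
      using assms(4)[of i] by (intro bexI[of _ i]) auto
    thus ?thesis using \<open>finite S\<close> by (rule prod_zero[rotated])
  qed
  have sub: "{p. p permutes (S - {m})} \<subseteq> {p. p permutes S}"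
    by (auto intro: permutes_subset)
  have "leibniz_det S B = (\<Sum>p | p permutes (S - {m}). sign p * (\<Prod>i\<in>S. B i (p i)))"
    unfolding leibniz_det_def
    by (rule sum.mono_neutral_right) (use \<open>finite S\<close> sub vanish in \<open>auto simp: finite_permutations\<close>)
  also have "\<dots> = leibniz_det (S - {m}) B"
    unfolding leibniz_det_def
  proof (rule sum.cong)
    fix p assume "p \<in> {p. p permutes (S - {m})}"
    hence "p m = m" by (auto simp: permutes_def)
    thus "sign p * (\<Prod>i\<in>S. B i (p i)) = sign p * (\<Prod>i\<in>S - {m}. B i (p i))"
      using assms by (simp add: prod.remove)
  qed simp
  finally show ?thesis .
qed

text \<open>
  Two minimal elements give two rows of ones; a unique minimal element gives a unit column.
\<close>

lemma leibniz_det_partial_order: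
  fixes lt :: "'a \<Rightarrow> 'a \<Rightarrow> bool"
  assumes "finite S"
    and irrefl: "\<And>x. x \<in> S \<Longrightarrow> \<not> lt x x"
    and trans: "\<And>x y z. x \<in> S \<Longrightarrow> y \<in> S \<Longrightarrow> z \<in> S \<Longrightarrow> lt x y \<Longrightarrow> lt y z \<Longrightarrow> lt x z"
  shows "leibniz_det S (\<lambda>i j. of_bool (\<not> lt j i)) =
    of_bool (\<forall>x\<in>S. \<forall>y\<in>S. x \<noteq> y \<longrightarrow> lt x y \<or> lt y x)"
  using assms
proof (induction S rule: finite_psubset_induct)
  case (psubset S)
  let ?B = "\<lambda>i j. of_bool (\<not> lt j i) :: int"
  show ?case
  proof (cases "S = {}")
    case True
    thus ?thesis by (simp add: leibniz_det_def)
  next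
    case False
    \<comment> \<open>Every \<open>x\<close> lies weakly above a minimal element: a minimal element
      of the finite set of elements weakly below \<open>x\<close> is minimal in all of
      \<open>S\<close> by transitivity.\<close>
    have below: "\<exists>m\<in>S. (m = x \<or> lt m x) \<and> (\<forall>y\<in>S. \<not> lt y m)" if "x \<in> S" for x
    proof -
      have asymp: "asymp_on S lt"
      proof (rule asymp_onI)
        fix y z assume "y \<in> S" "z \<in> S" "lt y z"
        thus "\<not> lt z y" using psubset.prems(1)[of y] psubset.prems(2)[of y z y] by auto
      qed
      have transp: "transp_on S lt"
        by (rule transp_onI) (rule psubset.prems(2))
      define T where "T = {y \<in> S. y = x \<or> lt y x}"
      have T: "finite T" "T \<noteq> {}" "T \<subseteq> S" using psubset.hyps that by (auto simp: T_def)
      obtain m where m: "m \<in> T" "\<forall>y\<in>T. y \<noteq> m \<longrightarrow> \<not> lt y m"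
        using Finite_Set.bex_min_element[OF T(1) asymp_on_subset[OF asymp T(3)]
          transp_on_subset[OF transp T(3)] T(2)] by blast
      have "m \<in> S" "m = x \<or> lt m x" using m(1) by (auto simp: T_def)
      moreover have "\<not> lt y m" if "y \<in> S" for y
      proof
        assume "lt y m"
        hence "y \<in> T" "y \<noteq> m"
          using that \<open>m \<in> S\<close> \<open>m = x \<or> lt m x\<close> \<open>x \<in> S\<close>
            psubset.prems(1)[of m] psubset.prems(2)[of y m x]
          by (auto simp: T_def)
        thus False using m(2) \<open>lt y m\<close> by simp
      qed
      ultimately show ?thesis by (intro bexI[of _ m]) auto
    qed
    then obtain m where m: "m \<in> S" "\<forall>y\<in>S. \<not> lt y m" using False by blast
    show ?thesis
    proof (cases "\<exists>m'\<in>S. m' \<noteq> m \<and> (\<forall>y\<in>S. \<not> lt y m')")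
      case True
      then obtain m' where m': "m' \<in> S" "m' \<noteq> m" "\<forall>y\<in>S. \<not> lt y m'" by blast
      \<comment> \<open>Rows \<open>m\<close> and \<open>m'\<close> both consist of ones. The right
        side is 0 as well, since two distinct minimal elements are incomparable.\<close>
      hence "leibniz_det S ?B = 0"
        using m psubset.hyps by (intro leibniz_det_identical_rows[of S m m']) auto
      thus ?thesis using m m' by force
    next
      case False
      \<comment> \<open>A unique minimal element lies below everything, so column \<open>m\<close>
        is a unit column, and removing \<open>m\<close> does not change whether \<open>S\<close> is
        a chain.\<close>
      have least: "lt m x" if "x \<in> S" "x \<noteq> m" for x
      proof -
        obtain m' where "m' \<in> S" "m' = x \<or> lt m' x" "\<forall>y\<in>S. \<not> lt y m'"
          using below[OF \<open>x \<in> S\<close>] by blast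
        thus ?thesis using False \<open>x \<noteq> m\<close> by auto
      qed
      have "leibniz_det S ?B = leibniz_det (S - {m}) ?B"
        using m least psubset.hyps by (intro leibniz_det_unit_column) auto
      also have "\<dots> = of_bool (\<forall>x\<in>S - {m}. \<forall>y\<in>S - {m}. x \<noteq> y \<longrightarrow> lt x y \<or> lt y x)"
      proof (rule psubset.IH)
        show "S - {m} \<subset> S" using m by blast
        show "\<not> lt x x" if "x \<in> S - {m}" for x
          using that psubset.prems(1) by blast
        show "lt x z" if "x \<in> S - {m}" "y \<in> S - {m}" "z \<in> S - {m}" "lt x y" "lt y z" for x y z
          using that psubset.prems(2)[of x y z] by blast
      qed
      also have "(\<forall>x\<in>S - {m}. \<forall>y\<in>S - {m}. x \<noteq> y \<longrightarrow> lt x y \<or> lt y x) \<longleftrightarrow>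
          (\<forall>x\<in>S. \<forall>y\<in>S. x \<noteq> y \<longrightarrow> lt x y \<or> lt y x)"
        using least by blast
      finally show ?thesis .
    qed
  qed
qed

text \<open>This computes the integer coefficient of \<open>T\<close> when the rows outside
  \<open>T\<close> contribute their unit entry. The factors outside \<open>T\<close> kill every
  permutation that moves a point there; the survivors permute \<open>T\<close> and keep their sign,
  and the minus signs collect to \<open>(- 1) ^ card T\<close>.\<close>

lemma sum_sign_mask:
  assumes "finite N" "T \<subseteq> N"
  shows "(\<Sum>p | p permutes N. sign p *
      ((\<Prod>i\<in>N - T. of_bool (p i = i)) * (\<Prod>i\<in>T. - B i (p i)))) =
    (- 1) ^ card T * leibniz_det T B"
proof -
  let ?f = "\<lambda>p. sign p * ((\<Prod>i\<in>N - T. of_bool (p i = i)) * (\<Prod>i\<in>T. - B i (p i)))"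
  have finT: "finite T" using assms finite_subset by blast
  have vanish: "?f p = 0" if p: "p permutes N" and np: "\<not> p permutes T" for p
  proof -
    obtain i where "i \<in> N - T" "p i \<noteq> i"
      using p np permutes_superset[of p N T] by auto
    hence "(\<Prod>i\<in>N - T. of_bool (p i = i)) = (0 :: int)"
      using assms by (intro prod_zero) auto
    thus ?thesis by simp
  qed
  have sub: "{p. p permutes T} \<subseteq> {p. p permutes N}"
    using assms by (auto intro: permutes_subset)
  have "(\<Sum>p | p permutes N. ?f p) = (\<Sum>p | p permutes T. ?f p)"
    by (rule sum.mono_neutral_right) (use assms sub vanish in \<open>auto simp: finite_permutations\<close>)
  also have "\<dots> = (\<Sum>p | p permutes T. (- 1) ^ card T * (sign p * (\<Prod>i\<in>T. B i (p i))))"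
  proof (rule sum.cong)
    fix p assume "p \<in> {p. p permutes T}"
    hence "(\<Prod>i\<in>N - T. of_bool (p i = i)) = (1 :: int)"
      by (intro prod.neutral) (auto simp: permutes_def)
    moreover have "(\<Prod>i\<in>T. - B i (p i)) = (- 1) ^ card T * (\<Prod>i\<in>T. B i (p i))"
      using prod.distrib[of "\<lambda>_. - 1" "\<lambda>i. B i (p i)" T] by simp
    ultimately show "?f p = (- 1) ^ card T * (sign p * (\<Prod>i\<in>T. B i (p i)))" by simp
  qed simp
  finally show ?thesis by (simp add: leibniz_det_def sum_distrib_left)
qed


section \<open>Expansion of the Cayley determinant\<close>

lemma (in abelian_monoid) finsum_swap:
  assumes "finite A" "finite B" "\<And>a b. a \<in> A \<Longrightarrow> b \<in> B \<Longrightarrow> f a b \<in> carrier G"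
  shows "(\<Oplus>a\<in>A. \<Oplus>b\<in>B. f a b) = (\<Oplus>b\<in>B. \<Oplus>a\<in>A. f a b)"
  using assms(1,3)
proof (induction A rule: finite_induct)
  case empty
  thus ?case by simp
next
  case (insert x A)
  have "(\<Oplus>b\<in>B. \<Oplus>a\<in>insert x A. f a b) = (\<Oplus>b\<in>B. f x b \<oplus> (\<Oplus>a\<in>A. f a b))"
    using insert by (intro finsum_cong') (auto simp: Pi_def intro!: finsum_closed)
  also have "\<dots> = (\<Oplus>b\<in>B. f x b) \<oplus> (\<Oplus>b\<in>B. \<Oplus>a\<in>A. f a b)"
    using insert by (intro finsum_addf) (auto intro!: finsum_closed)
  finally show ?case
    using insert by (simp add: Pi_def finsum_closed)
qed

lemma add_pow_int_zero [simp]: "[(0 :: int)] \<cdot>\<^bsub>R\<^esub> x = \<zero>\<^bsub>R\<^esub>"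
  by (simp add: add_pow_def)

lemma (in abelian_group) add_pow_sum:
  fixes k :: "'c \<Rightarrow> int"
  assumes "finite A" "x \<in> carrier G"
  shows "[(\<Sum>a\<in>A. k a)] \<cdot> x = (\<Oplus>a\<in>A. [(k a)] \<cdot> x)"
  using assms
  by (induction A rule: finite_induct) (simp_all add: Pi_def add.int_pow_mult)

lemma (in abelian_group) add_pow_finsum:
  fixes k :: int
  assumes "finite A" "f \<in> A \<rightarrow> carrier G"
  shows "[k] \<cdot> (\<Oplus>a\<in>A. f a) = (\<Oplus>a\<in>A. [k] \<cdot> f a)"
  using assms
  by (induction A rule: finite_induct) (simp_all add: Pi_def add.int_pow_distrib)

section \<open>Ordered products and the expansion of the determinant over subsets\<close>

lemma (in ring) ring_list_prod_closed:
  "set xs \<subseteq> carrier R \<Longrightarrow> ring_list_prod R xs \<in> carrier R"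
  unfolding ring_list_prod_def by (induction xs) auto

lemma ring_list_prod_simps [simp]:
  "ring_list_prod R [] = \<one>\<^bsub>R\<^esub>"
  "ring_list_prod R (x # xs) = x \<otimes>\<^bsub>R\<^esub> ring_list_prod R xs"
  by (simp_all add: ring_list_prod_def)

text \<open>Distributivity: \<open>T\<close> records the factors from which the \<open>g\<close>
  term is chosen rather than the unit term. Integer multiples can be pulled to the front, whereas
  the chosen \<open>g i\<close> keep the order of the list because they need not commute.\<close>

lemma (in ring) ring_list_prod_binomial:
  fixes a b :: "'c \<Rightarrow> int"
  assumes "distinct xs" "g \<in> set xs \<rightarrow> carrier R"
  shows "ring_list_prod R (map (\<lambda>i. [(a i)] \<cdot> \<one> \<oplus> [(b i)] \<cdot> g i) xs) =
    (\<Oplus>T\<in>Pow (set xs). [((\<Prod>i\<in>set xs - T. a i) * (\<Prod>i\<in>T. b i))] \<cdot>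
      ring_list_prod R (map g (filter (\<lambda>i. i \<in> T) xs)))"
  using assms
proof (induction xs)
  case Nil
  have "[(1 :: int)] \<cdot> \<one> = \<one>" by (rule add.int_pow_1) simp
  thus ?case by simp
next
  case (Cons x xs)
  define m where "m = (\<lambda>T. ring_list_prod R (map g (filter (\<lambda>i. i \<in> T) xs)))"
  define c where "c = (\<lambda>T. (\<Prod>i\<in>set xs - T. a i) * (\<Prod>i\<in>T. b i))"
  define P where "P = (\<Oplus>T\<in>Pow (set xs). [(c T)] \<cdot> m T)"
  define F where "F = (\<lambda>T. [((\<Prod>i\<in>set (x # xs) - T. a i) * (\<Prod>i\<in>T. b i))] \<cdot>
    ring_list_prod R (map g (filter (\<lambda>i. i \<in> T) (x # xs))))"
  have x: "x \<notin> set xs" and gx: "g x \<in> carrier R" and g: "\<And>i. i \<in> set xs \<Longrightarrow> g i \<in> carrier R"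
    using Cons.prems by auto
  have m: "m T \<in> carrier R" for T
    unfolding m_def using g by (intro ring_list_prod_closed) auto
  have P: "P \<in> carrier R"
    unfolding P_def using m by (intro finsum_closed) auto
  \<comment> \<open>A subset without \<open>x\<close> takes the unit term from the first
    factor.\<close>
  have F0: "F T = [(a x)] \<cdot> ([(c T)] \<cdot> m T)" if "T \<in> Pow (set xs)" for T
  proof -
    have "set (x # xs) - T = insert x (set xs - T)" "x \<notin> set xs - T" "x \<notin> T"
      using that x by auto
    thus ?thesis
      using m[of T] by (simp add: F_def m_def c_def add.int_pow_pow mult_ac)
  qed
  \<comment> \<open>A subset with \<open>x\<close> takes \<open>g x\<close> from the first factor,
    which puts it leftmost in the monomial.\<close>
  have F1: "F (insert x T) = [(b x)] \<cdot> (g x \<otimes> ([(c T)] \<cdot> m T))" if "T \<in> Pow (set xs)" for T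
  proof -
    have "set (x # xs) - insert x T = set xs - T" "x \<notin> T" "finite T"
      using that x finite_subset by auto
    moreover have "filter (\<lambda>i. i = x \<or> i \<in> T) xs = filter (\<lambda>i. i \<in> T) xs"
      using x by (intro filter_cong) auto
    ultimately show ?thesis
      using m[of T] gx by (simp add: F_def m_def c_def add.int_pow_pow add_pow_rdistr_int mult_ac)
  qed
  have closed: "F T \<in> carrier R" if "T \<in> Pow (set (x # xs))" for T
    unfolding F_def using g gx by (intro add.int_pow_closed ring_list_prod_closed) auto
  have closed': "F (insert x T) \<in> carrier R" if "T \<in> Pow (set xs)" for T
    using that by (intro closed) auto
  have inj: "inj_on (insert x) (Pow (set xs))"
    using x by (intro inj_onI) auto
  \<comment> \<open>Split the subsets by whether they contain \<open>x\<close>; both halves are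
    indexed by the subsets of \<open>set xs\<close>.\<close>
  have "(\<Oplus>T\<in>Pow (set (x # xs)). F T) =
      (\<Oplus>T\<in>Pow (set xs). F T) \<oplus> (\<Oplus>T\<in>insert x ` Pow (set xs). F T)"
    unfolding list.set(2) Pow_insert
    by (rule finsum_Un_disjoint) (use x closed closed' in auto)
  also have "(\<Oplus>T\<in>insert x ` Pow (set xs). F T) = (\<Oplus>T\<in>Pow (set xs). F (insert x T))"
    by (rule finsum_reindex) (use inj closed' in auto)
  also have "\<dots> = (\<Oplus>T\<in>Pow (set xs). [(b x)] \<cdot> (g x \<otimes> ([(c T)] \<cdot> m T)))"
    by (rule finsum_cong') (use F1 gx m in auto)
  also have "\<dots> = [(b x)] \<cdot> (g x \<otimes> P)"
    unfolding P_def using gx m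
    by (subst finsum_rdistr) (auto simp: add_pow_finsum Pi_def)
  also have "(\<Oplus>T\<in>Pow (set xs). F T) = (\<Oplus>T\<in>Pow (set xs). [(a x)] \<cdot> ([(c T)] \<cdot> m T))"
    by (rule finsum_cong') (use F0 gx m in auto)
  also have "\<dots> = [(a x)] \<cdot> P"
    unfolding P_def using m by (subst add_pow_finsum) auto
  finally have "(\<Oplus>T\<in>Pow (set (x # xs)). F T) = [(a x)] \<cdot> P \<oplus> [(b x)] \<cdot> (g x \<otimes> P)" .
  moreover have "ring_list_prod R (map (\<lambda>i. [(a i)] \<cdot> \<one> \<oplus> [(b i)] \<cdot> g i) xs) = P"
    using Cons unfolding P_def c_def m_def by simp
  ultimately show ?case
    using P gx unfolding F_def by (simp add: l_distr add_pow_ldistr_int)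
qed

text \<open>Left multiplication by the diagonal matrix scales row \<open>i\<close> by
  \<open>g i\<close>. The entry is written with integer multiples of the unit and of
  \<open>g i\<close>, the form needed for the subset expansion of a product of rows.\<close>

lemma (in ring) matrix_entry:
  assumes "i \<in> {1..n}" "j \<in> {1..n}" "\<And>k. k \<in> {1..n} \<Longrightarrow> g k \<in> carrier R"
  shows "matrix_minus R (one_matrix R) (matrix_mult R n (diag_matrix R g) (adjacency_matrix R h D)) i j =
    [(of_bool (j = i) :: int)] \<cdot> \<one> \<oplus> [(- of_bool ((h i, h j) \<in> parcs D) :: int)] \<cdot> g i"
proof -
  let ?A = "adjacency_matrix R h D"
  have A: "?A i j \<in> carrier R" for i j
    by (simp add: adjacency_matrix_def)
  have "matrix_mult R n (diag_matrix R g) ?A i j =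
      (\<Oplus>k\<in>{1..n}. if i = k then g k \<otimes> ?A k j else \<zero>)"
    unfolding matrix_mult_def diag_matrix_def
    by (rule finsum_cong') (use assms A in auto)
  also have "\<dots> = g i \<otimes> ?A i j"
    using assms A by (intro add.finprod_singleton) auto
  also have "\<ominus> \<dots> = [(- of_bool ((h i, h j) \<in> parcs D) :: int)] \<cdot> g i"
    using assms by (simp add: adjacency_matrix_def add.int_pow_neg)
  finally show ?thesis
    using assms by (simp add: matrix_minus_def one_matrix_def minus_eq)
qed

text \<open>Row \<open>i\<close> offers the generator \<open>g i\<close> whatever the column, and
  the product runs in increasing row order, so the monomial of \<open>T\<close> is the same for all
  permutations. Exchanging the two sums therefore leaves an ordinary integer determinant as the
  coefficient of each monomial.\<close>

lemma (in ring) Cdet_one_minus_diag_adjacency: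
  assumes "g \<in> {1..n} \<rightarrow> carrier R"
  shows "Cdet R n (matrix_minus R (one_matrix R)
      (matrix_mult R n (diag_matrix R g) (adjacency_matrix R h D))) =
    (\<Oplus>T\<in>Pow {1..n}.
      [((- 1) ^ card T * leibniz_det T (\<lambda>i j. of_bool ((h i, h j) \<in> parcs D)))] \<cdot>
      ring_list_prod R (map g (filter (\<lambda>i. i \<in> T) [1..<Suc n])))"
proof -
  let ?X = "matrix_minus R (one_matrix R) (matrix_mult R n (diag_matrix R g) (adjacency_matrix R h D))"
  let ?B = "\<lambda>i j. of_bool ((h i, h j) \<in> parcs D) :: int"
  define m where "m = (\<lambda>T. ring_list_prod R (map g (filter (\<lambda>i. i \<in> T) [1..<Suc n])))"
  define c where "c = (\<lambda>\<sigma> T. (\<Prod>i\<in>{1..n} - T. of_bool (\<sigma> i = i)) * (\<Prod>i\<in>T. - ?B i (\<sigma> i)))"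
  have set: "set [1..<Suc n] = {1..n}" by auto
  have m: "m T \<in> carrier R" for T
    unfolding m_def using assms by (intro ring_list_prod_closed) auto
  have expand: "[sign \<sigma>] \<cdot> ring_list_prod R (map (\<lambda>i. ?X i (\<sigma> i)) [1..<Suc n]) =
      (\<Oplus>T\<in>Pow {1..n}. [(sign \<sigma> * c \<sigma> T)] \<cdot> m T)" if "\<sigma> permutes {1..n}" for \<sigma>
  proof -
    have "map (\<lambda>i. ?X i (\<sigma> i)) [1..<Suc n] =
        map (\<lambda>i. [(of_bool (\<sigma> i = i) :: int)] \<cdot> \<one> \<oplus> [(- ?B i (\<sigma> i))] \<cdot> g i) [1..<Suc n]"
    proof (rule map_cong[OF HOL.refl])
      fix i assume "i \<in> set [1..<Suc n]"
      hence i: "i \<in> {1..n}" by (simp only: set)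
      hence "\<sigma> i \<in> {1..n}" using permutes_in_image[OF that] by blast
      with i show "?X i (\<sigma> i) =
          [(of_bool (\<sigma> i = i) :: int)] \<cdot> \<one> \<oplus> [(- ?B i (\<sigma> i))] \<cdot> g i"
        using assms by (intro matrix_entry) auto
    qed
    also have "ring_list_prod R \<dots> = (\<Oplus>T\<in>Pow {1..n}. [(c \<sigma> T)] \<cdot> m T)"
      using ring_list_prod_binomial[of "[1..<Suc n]" g "\<lambda>i. of_bool (\<sigma> i = i)" "\<lambda>i. - ?B i (\<sigma> i)"] assms
      unfolding set c_def m_def by simp
    also have "[sign \<sigma>] \<cdot> \<dots> = (\<Oplus>T\<in>Pow {1..n}. [sign \<sigma>] \<cdot> ([(c \<sigma> T)] \<cdot> m T))"
      using m by (intro add_pow_finsum) auto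
    also have "\<dots> = (\<Oplus>T\<in>Pow {1..n}. [(sign \<sigma> * c \<sigma> T)] \<cdot> m T)"
      using m by (intro finsum_cong') (auto simp: add.int_pow_pow mult.commute)
    finally show ?thesis .
  qed
  have fin: "finite {\<sigma>. \<sigma> permutes {1..n}}" by (simp add: finite_permutations)
  have "Cdet R n ?X = (\<Oplus>\<sigma>\<in>{\<sigma>. \<sigma> permutes {1..n}}. \<Oplus>T\<in>Pow {1..n}. [(sign \<sigma> * c \<sigma> T)] \<cdot> m T)"
    unfolding Cdet_def using expand m by (intro finsum_cong') (auto intro!: finsum_closed)
  also have "\<dots> = (\<Oplus>T\<in>Pow {1..n}. \<Oplus>\<sigma>\<in>{\<sigma>. \<sigma> permutes {1..n}}. [(sign \<sigma> * c \<sigma> T)] \<cdot> m T)"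
    using fin m by (intro finsum_swap) auto
  \<comment> \<open>Since \<open>m T\<close> is free of \<open>\<sigma>\<close>, the inner sum takes
    place in the integer coefficients.\<close>
  also have "\<dots> = (\<Oplus>T\<in>Pow {1..n}. [((- 1) ^ card T * leibniz_det T ?B)] \<cdot> m T)"
  proof (rule finsum_cong')
    fix T assume "T \<in> Pow {1..n}"
    hence "(\<Sum>\<sigma> | \<sigma> permutes {1..n}. sign \<sigma> * c \<sigma> T) = (- 1) ^ card T * leibniz_det T ?B"
      unfolding c_def by (intro sum_sign_mask) auto
    moreover have "(\<Oplus>\<sigma>\<in>{\<sigma>. \<sigma> permutes {1..n}}. [(sign \<sigma> * c \<sigma> T)] \<cdot> m T) =
        [(\<Sum>\<sigma> | \<sigma> permutes {1..n}. sign \<sigma> * c \<sigma> T)] \<cdot> m T"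
      by (rule add_pow_sum[symmetric]) (use fin m in auto)
    ultimately show "(\<Oplus>\<sigma>\<in>{\<sigma>. \<sigma> permutes {1..n}}. [(sign \<sigma> * c \<sigma> T)] \<cdot> m T) =
        [((- 1) ^ card T * leibniz_det T ?B)] \<cdot> m T" by simp
  qed (use m in auto)
  finally show ?thesis unfolding m_def .
qed

section \<open>Products of pairwise commuting factors\<close>

lemma (in ring) ring_list_prod_commuting:
  assumes "distinct xs" "distinct ys" "set xs = set ys" "f \<in> set xs \<rightarrow> carrier R"
    and "\<And>x y. x \<in> set xs \<Longrightarrow> y \<in> set xs \<Longrightarrow> x \<noteq> y \<Longrightarrow> f x \<otimes> f y = f y \<otimes> f x"
  shows "ring_list_prod R (map f xs) = ring_list_prod R (map f ys)"
  using assms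
proof (induction xs arbitrary: ys)
  case Nil
  thus ?case by simp
next
  case (Cons x xs)
  \<comment> \<open>Locate the head \<open>x\<close> in the other enumeration; once
    \<open>f x\<close> is moved to the front there, the induction hypothesis handles the remaining
    list \<open>us @ vs\<close>.\<close>
  obtain us vs where ys: "ys = us @ x # vs"
    using Cons.prems(3) by (metis list.set_intros(1) split_list)
  have xs: "set xs = set (us @ vs)" "x \<notin> set (us @ vs)" "distinct (us @ vs)"
    using Cons.prems(1-3) unfolding ys by auto
  have fx: "f x \<in> carrier R" and fxs: "f ` set (us @ vs) \<subseteq> carrier R"
    using Cons.prems(4) xs(1) by auto
  have comm: "f x \<otimes> f y = f y \<otimes> f x" if "y \<in> set (us @ vs)" for y
    using Cons.prems(5)[of x y] that xs by auto
  \<comment> \<open>Inner induction on the prefix \<open>us\<close>: \<open>f x\<close> passes one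
    factor at a time.\<close>
  have "ring_list_prod R (map f (us @ x # vs)) = f x \<otimes> ring_list_prod R (map f (us @ vs))"
    using fxs comm
  proof (induction us)
    case (Cons u us)
    define p where "p = ring_list_prod R (map f (us @ vs))"
    have fu: "f u \<in> carrier R" and us: "f ` set (us @ vs) \<subseteq> carrier R"
      using Cons.prems(1) by auto
    have p: "p \<in> carrier R"
      unfolding p_def by (rule ring_list_prod_closed) (use us in \<open>simp only: set_map\<close>)
    have "ring_list_prod R (map f (us @ x # vs)) = f x \<otimes> p"
      unfolding p_def by (rule Cons.IH[OF us]) (rule Cons.prems(2), simp)
    hence "ring_list_prod R (map f ((u # us) @ x # vs)) = f u \<otimes> (f x \<otimes> p)"
      by simp
    also have "\<dots> = f u \<otimes> f x \<otimes> p"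
      using fx fu p by (simp only: m_assoc)
    also have "f u \<otimes> f x = f x \<otimes> f u"
      by (rule Cons.prems(2)[symmetric]) simp
    also have "f x \<otimes> f u \<otimes> p = f x \<otimes> (f u \<otimes> p)"
      using fx fu p by (rule m_assoc)
    finally show ?case by (simp add: p_def)
  qed simp
  also have "ring_list_prod R (map f (us @ vs)) = ring_list_prod R (map f xs)"
  proof (rule Cons.IH[symmetric])
    show "f y \<otimes> f z = f z \<otimes> f y" if "y \<in> set xs" "z \<in> set xs" "y \<noteq> z" for y z
      by (rule Cons.prems(5)) (use that in auto)
  qed (use Cons.prems(1,4) xs in auto)
  finally show ?case by (simp add: ys)
qed

text \<open>The enumeration fixed by the choice operator may be exchanged for any convenient
  one.\<close>

lemma (in ring) commuting_prod_eq:
  assumes "distinct xs" "f \<in> set xs \<rightarrow> carrier R"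
    and "\<And>x y. x \<in> set xs \<Longrightarrow> y \<in> set xs \<Longrightarrow> x \<noteq> y \<Longrightarrow> f x \<otimes> f y = f y \<otimes> f x"
  shows "commuting_prod R f (set xs) = ring_list_prod R (map f xs)"
proof -
  define ys where "ys = (SOME ys. distinct ys \<and> set ys = set xs)"
  have ys: "distinct ys \<and> set ys = set xs"
    unfolding ys_def by (rule someI[of _ xs]) (use assms(1) in simp)
  have "ring_list_prod R (map f xs) = ring_list_prod R (map f ys)"
    using assms(1) ys[THEN conjunct1] ys[THEN conjunct2, symmetric] assms(2,3)
    by (rule ring_list_prod_commuting)
  thus ?thesis
    unfolding commuting_prod_def ys_def[symmetric] by (rule HOL.sym)
qed


section \<open>Trace monoids and their monoid rings\<close>

lemma trace_cong_lists: "(u, v) \<in> trace_cong S I \<Longrightarrow> u \<in> lists S \<and> v \<in> lists S"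
  by (induction rule: trace_cong.induct) auto

lemma equiv_trace_cong: "equiv (lists S) (trace_cong S I)"
proof (rule equivI)
  show "trace_cong S I \<subseteq> lists S \<times> lists S" using trace_cong_lists by fast
qed (auto intro!: refl_onI symI transI intro: trace_cong.intros)

lemma trace_class_eq_iff:
  "u \<in> lists S \<Longrightarrow> v \<in> lists S \<Longrightarrow>
    trace_class S I u = trace_class S I v \<longleftrightarrow> (u, v) \<in> trace_cong S I"
  unfolding trace_class_def by (rule eq_equiv_class_iff[OF equiv_trace_cong])

lemma trace_monoid_carrier: "carrier (trace_monoid S I) = trace_class S I ` lists S"
  by (auto simp: trace_monoid_def quotient_def trace_class_def)

text \<open>The congruence respects concatenation, so the union over all representatives in the
  definition of the product is a union of copies of a single class.\<close>

lemma trace_monoid_mult: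
  assumes "u \<in> lists S" "v \<in> lists S"
  shows "trace_class S I u \<otimes>\<^bsub>trace_monoid S I\<^esub> trace_class S I v = trace_class S I (u @ v)"
proof -
  let ?X = "trace_class S I u" and ?Y = "trace_class S I v"
  have "trace_class S I (u' @ v') = trace_class S I (u @ v)" if "u' \<in> ?X" "v' \<in> ?Y" for u' v'
  proof -
    have "(u, u') \<in> trace_cong S I" "(v, v') \<in> trace_cong S I"
      using that by (simp_all add: trace_class_def)
    hence "(u @ v, u' @ v') \<in> trace_cong S I" by (rule trace_cong.append)
    thus ?thesis
      using trace_cong_lists trace_class_eq_iff by metis
  qed
  hence "(\<Union>u'\<in>?X. \<Union>v'\<in>?Y. trace_class S I (u' @ v')) =
      (\<Union>u'\<in>?X. \<Union>v'\<in>?Y. trace_class S I (u @ v))"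
    by (intro SUP_cong HOL.refl)
  \<comment> \<open>Both classes are nonempty; otherwise the union of the constant family would be
    empty.\<close>
  moreover have "u \<in> ?X" "v \<in> ?Y"
    using assms by (simp_all add: trace_class_def trace_cong.refl)
  ultimately show ?thesis
    by (auto simp only: trace_monoid_def monoid.simps UN_constant split: if_splits)
qed

lemma trace_monoid_one: "\<one>\<^bsub>trace_monoid S I\<^esub> = trace_class S I []"
  by (simp add: trace_monoid_def)

lemma monoid_trace_monoid: "monoid (trace_monoid S I)"
proof (rule monoidI)
  fix x y z
  assume "x \<in> carrier (trace_monoid S I)" "y \<in> carrier (trace_monoid S I)"
    "z \<in> carrier (trace_monoid S I)"
  then obtain u v w where *: "x = trace_class S I u" "u \<in> lists S"
      "y = trace_class S I v" "v \<in> lists S" "z = trace_class S I w" "w \<in> lists S"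
    unfolding trace_monoid_carrier by blast
  have uv: "u @ v \<in> lists S" "v @ w \<in> lists S"
    using * by simp_all
  show "x \<otimes>\<^bsub>trace_monoid S I\<^esub> y \<in> carrier (trace_monoid S I)"
    using * uv(1) by (simp only: trace_monoid_mult trace_monoid_carrier image_eqI)
  show "x \<otimes>\<^bsub>trace_monoid S I\<^esub> y \<otimes>\<^bsub>trace_monoid S I\<^esub> z =
      x \<otimes>\<^bsub>trace_monoid S I\<^esub> (y \<otimes>\<^bsub>trace_monoid S I\<^esub> z)"
    using * uv by (simp only: trace_monoid_mult append_assoc)
  show "\<one>\<^bsub>trace_monoid S I\<^esub> \<otimes>\<^bsub>trace_monoid S I\<^esub> x = x"
    "x \<otimes>\<^bsub>trace_monoid S I\<^esub> \<one>\<^bsub>trace_monoid S I\<^esub> = x"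
    using * by (simp_all only: trace_monoid_one trace_monoid_mult lists.Nil append_Nil append_Nil2)
qed (simp add: trace_monoid_one trace_monoid_carrier)

section \<open>The monoid ring over the integers\<close>

lemma int_monoid_ring_mult_eq:
  assumes "finite A" "finite B" "Poly_Mapping.keys f \<subseteq> A" "Poly_Mapping.keys g \<subseteq> B"
  shows "f \<otimes>\<^bsub>int_monoid_ring M\<^esub> g = (\<Sum>x\<in>A. \<Sum>y\<in>B.
    Poly_Mapping.single (x \<otimes>\<^bsub>M\<^esub> y) (Poly_Mapping.lookup f x * Poly_Mapping.lookup g y))"
proof -
  have "f \<otimes>\<^bsub>int_monoid_ring M\<^esub> g = (\<Sum>x\<in>Poly_Mapping.keys f. \<Sum>y\<in>B.
      Poly_Mapping.single (x \<otimes>\<^bsub>M\<^esub> y) (Poly_Mapping.lookup f x * Poly_Mapping.lookup g y))"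
    unfolding int_monoid_ring_def monoid.simps using assms
    by (intro sum.cong sum.mono_neutral_left) (auto simp: in_keys_iff)
  also have "\<dots> = (\<Sum>x\<in>A. \<Sum>y\<in>B.
      Poly_Mapping.single (x \<otimes>\<^bsub>M\<^esub> y) (Poly_Mapping.lookup f x * Poly_Mapping.lookup g y))"
    using assms by (intro sum.mono_neutral_left) (auto simp: in_keys_iff)
  finally show ?thesis .
qed

text \<open>Cancellation can make the support of \<open>f + g\<close> smaller than the union of the
  two supports, so all three products are first written over that union.\<close>

lemma int_monoid_ring_add_mult:
  "(f + g) \<otimes>\<^bsub>int_monoid_ring M\<^esub> k =
    f \<otimes>\<^bsub>int_monoid_ring M\<^esub> k + g \<otimes>\<^bsub>int_monoid_ring M\<^esub> k"
proof -
  let ?A = "Poly_Mapping.keys f \<union> Poly_Mapping.keys g" and ?B = "Poly_Mapping.keys k"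
  show ?thesis
    using Poly_Mapping.keys_add[of f g]
    by (simp add: int_monoid_ring_mult_eq[of ?A ?B] lookup_add distrib_right single_add sum.distrib)
qed

lemma int_monoid_ring_mult_add:
  "k \<otimes>\<^bsub>int_monoid_ring M\<^esub> (f + g) =
    k \<otimes>\<^bsub>int_monoid_ring M\<^esub> f + k \<otimes>\<^bsub>int_monoid_ring M\<^esub> g"
proof -
  let ?A = "Poly_Mapping.keys f \<union> Poly_Mapping.keys g" and ?B = "Poly_Mapping.keys k"
  show ?thesis
    using Poly_Mapping.keys_add[of f g]
    by (simp add: int_monoid_ring_mult_eq[of ?B ?A] lookup_add distrib_left single_add sum.distrib)
qed

lemma int_monoid_ring_mult_single:
  "Poly_Mapping.single x a \<otimes>\<^bsub>int_monoid_ring M\<^esub> Poly_Mapping.single y b =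
    Poly_Mapping.single (x \<otimes>\<^bsub>M\<^esub> y) (a * b)"
  by (subst int_monoid_ring_mult_eq[of "{x}" "{y}"]) (auto simp: lookup_single)

lemma int_monoid_ring_zero_mult:
  "0 \<otimes>\<^bsub>int_monoid_ring M\<^esub> f = 0" "f \<otimes>\<^bsub>int_monoid_ring M\<^esub> 0 = 0"
  by (simp_all add: int_monoid_ring_def)

text \<open>Every element is the finite sum of its monomials, so a property preserved by sums has to
  be checked on monomials and on 0 only.\<close>

lemma int_monoid_ring_induct [consumes 1, case_names zero single add]:
  assumes f: "f \<in> carrier (int_monoid_ring M)"
    and "P 0"
    and single: "\<And>x a. x \<in> carrier M \<Longrightarrow> P (Poly_Mapping.single x a)"
    and add: "\<And>f g. P f \<Longrightarrow> P g \<Longrightarrow> P (f + g)"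
  shows "P f"
proof -
  have "P (\<Sum>x\<in>A. Poly_Mapping.single x (Poly_Mapping.lookup f x))"
    if "finite A" "A \<subseteq> carrier M" for A
    using that by (induction A rule: finite_induct) (simp_all add: assms)
  moreover have "f = (\<Sum>x\<in>Poly_Mapping.keys f. Poly_Mapping.single x (Poly_Mapping.lookup f x))"
    by (rule poly_mapping_eqI) (simp add: lookup_sum lookup_single when_def in_keys_iff)
  moreover have "finite (Poly_Mapping.keys f)" "Poly_Mapping.keys f \<subseteq> carrier M"
    using f by (simp_all add: int_monoid_ring_def)
  ultimately show ?thesis by metis
qed

text \<open>Closure, associativity and the unit laws are additive in each argument, which reduces
  them to monomials, where they are the laws of \<open>M\<close>.\<close>

lemma ring_int_monoid_ring:
  assumes "monoid M"
  shows "ring (int_monoid_ring M)"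
proof -
  interpret M: monoid M by fact
  let ?R = "int_monoid_ring M"
  have add: "f \<oplus>\<^bsub>?R\<^esub> g = f + g" and zero: "\<zero>\<^bsub>?R\<^esub> = 0"
    and one: "\<one>\<^bsub>?R\<^esub> = Poly_Mapping.single \<one>\<^bsub>M\<^esub> 1"
    and carrier: "f \<in> carrier ?R \<longleftrightarrow> Poly_Mapping.keys f \<subseteq> carrier M" for f g
    by (simp_all add: int_monoid_ring_def)
  have add_closed: "f + g \<in> carrier ?R" if "f \<in> carrier ?R" "g \<in> carrier ?R" for f g
    using that Poly_Mapping.keys_add[of f g] by (auto simp: carrier)
  have single_closed: "Poly_Mapping.single x a \<in> carrier ?R" if "x \<in> carrier M" for x a
    using that by (auto simp: carrier)
  have closed: "f \<otimes>\<^bsub>?R\<^esub> g \<in> carrier ?R" if f: "f \<in> carrier ?R" and g: "g \<in> carrier ?R" for f g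
    using f
  proof (induction f rule: int_monoid_ring_induct)
    case (single x a)
    show ?case
      using g by (induction g rule: int_monoid_ring_induct)
        (auto simp: int_monoid_ring_zero_mult int_monoid_ring_mult_add int_monoid_ring_mult_single
          single single_closed add_closed, simp add: carrier)
  qed (auto simp: int_monoid_ring_zero_mult int_monoid_ring_add_mult add_closed, simp add: carrier)
  have assoc: "(f \<otimes>\<^bsub>?R\<^esub> g) \<otimes>\<^bsub>?R\<^esub> k = f \<otimes>\<^bsub>?R\<^esub> (g \<otimes>\<^bsub>?R\<^esub> k)"
    if f: "f \<in> carrier ?R" and g: "g \<in> carrier ?R" and k: "k \<in> carrier ?R" for f g k
    using f
  proof (induction f rule: int_monoid_ring_induct)
    case (single x a)
    show ?case
      using g
    proof (induction g rule: int_monoid_ring_induct)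
      case (single y b)
      show ?case
        using k by (induction k rule: int_monoid_ring_induct)
          (auto simp: int_monoid_ring_zero_mult int_monoid_ring_mult_add
            int_monoid_ring_mult_single \<open>x \<in> carrier M\<close> single M.m_assoc mult.assoc)
    qed (auto simp: int_monoid_ring_zero_mult int_monoid_ring_add_mult int_monoid_ring_mult_add)
  qed (auto simp: int_monoid_ring_zero_mult int_monoid_ring_add_mult)
  have one_mult: "\<one>\<^bsub>?R\<^esub> \<otimes>\<^bsub>?R\<^esub> f = f" "f \<otimes>\<^bsub>?R\<^esub> \<one>\<^bsub>?R\<^esub> = f" if "f \<in> carrier ?R" for f
    using that by (induction f rule: int_monoid_ring_induct)
      (auto simp: one int_monoid_ring_zero_mult int_monoid_ring_mult_add int_monoid_ring_add_mult
        int_monoid_ring_mult_single)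
  show ?thesis
  proof (rule ringI)
    show "abelian_group ?R"
    proof (rule abelian_groupI)
      fix f assume "f \<in> carrier ?R"
      thus "\<exists>g\<in>carrier ?R. g \<oplus>\<^bsub>?R\<^esub> f = \<zero>\<^bsub>?R\<^esub>"
        \<comment> \<open>Negation does not change the support, so \<open>- f\<close> stays in the
          carrier.\<close>
        by (intro bexI[of _ "- f"]) (auto simp: add zero carrier)
    qed (auto simp: add zero add_closed add.assoc add.commute, simp add: carrier)
    show "Group.monoid ?R"
      by (rule monoidI) (auto simp: closed assoc one_mult, auto simp: one single_closed)
  qed (auto simp: add int_monoid_ring_mult_add int_monoid_ring_add_mult)
qed


section \<open>The hike ring and closures\<close>

lemma ring_hike_ring: "ring (hike_ring G)"
  unfolding hike_ring_def hike_monoid_def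
  by (intro ring_int_monoid_ring monoid_trace_monoid)

lemma hike_gen_closed: "x \<in> hikes_alphabet G \<Longrightarrow> hike_gen G x \<in> carrier (hike_ring G)"
  by (auto simp: hike_gen_def hike_ring_def hike_monoid_def int_monoid_ring_def trace_monoid_carrier)

lemma hikes_independence_sym: "(x, y) \<in> hikes_independence G \<Longrightarrow> (y, x) \<in> hikes_independence G"
  by (auto simp: hikes_independence_def)

text \<open>The words \<open>[x, y]\<close> and \<open>[y, x]\<close> represent the same hike; this
  makes the product over a clique independent of its order.\<close>

lemma hike_gen_commute:
  assumes "(x, y) \<in> hikes_independence G"
  shows "hike_gen G x \<otimes>\<^bsub>hike_ring G\<^esub> hike_gen G y = hike_gen G y \<otimes>\<^bsub>hike_ring G\<^esub> hike_gen G x"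
proof -
  have S: "x \<in> hikes_alphabet G" "y \<in> hikes_alphabet G"
    using assms by (auto simp: hikes_independence_def)
  hence "trace_class (hikes_alphabet G) (hikes_independence G) [x, y] =
      trace_class (hikes_alphabet G) (hikes_independence G) [y, x]"
    using assms by (subst trace_class_eq_iff) (auto intro: trace_cong.swap)
  thus ?thesis
    using S by (simp add: hike_gen_def hike_ring_def hike_monoid_def int_monoid_ring_mult_single
        trace_monoid_mult)
qed

lemma commutation_graph_vertices: "fst (commutation_graph G) = hikes_alphabet G"
  by (simp add: commutation_graph_def)

text \<open>An edge determines its ends only up to order, which is harmless because independence is
  symmetric.\<close>

lemma commutation_graph_edge_iff:
  "{x, y} \<in> snd (commutation_graph G) \<longleftrightarrow> (x, y) \<in> hikes_independence G"
proof -
  have "(\<exists>h k. {x, y} = {h, k} \<and> (h, k) \<in> hikes_independence G) \<longleftrightarrow> (x, y) \<in> hikes_independence G"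
    using hikes_independence_sym by (metis doubleton_eq_iff)
  thus ?thesis by (simp add: commutation_graph_def)
qed

lemma noncommutation_graph_edge_iff:
  assumes "x \<in> hikes_alphabet G" "y \<in> hikes_alphabet G"
  shows "{x, y} \<in> snd (noncommutation_graph G) \<longleftrightarrow> (x, y) \<notin> hikes_independence G"
proof -
  have "(\<exists>h k. {x, y} = {h, k} \<and> h \<in> hikes_alphabet G \<and> k \<in> hikes_alphabet G \<and>
      (h, k) \<notin> hikes_independence G) \<longleftrightarrow> (x, y) \<notin> hikes_independence G"
    using assms hikes_independence_sym by (metis doubleton_eq_iff)
  thus ?thesis by (simp add: noncommutation_graph_def)
qed

text \<open>
  The relation \<open>(y, x) \<notin> parcs D\<close>, read as \<open>x < y\<close>, is a strict partial order on the simple cycles whose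
  comparable pairs are exactly the commuting ones.
\<close>

lemma
  fixes G :: "'v pair_pre_digraph"
  assumes "is_closure (noncommutation_graph G) D"
  shows closure_irrefl: "x \<in> hikes_alphabet G \<Longrightarrow> (x, x) \<in> parcs D"
    and closure_comparable: "x \<in> hikes_alphabet G \<Longrightarrow> y \<in> hikes_alphabet G \<Longrightarrow> x \<noteq> y \<Longrightarrow>
      (x, y) \<in> hikes_independence G \<longleftrightarrow> (y, x) \<notin> parcs D \<or> (x, y) \<notin> parcs D"
    and closure_trans: "x \<in> hikes_alphabet G \<Longrightarrow> y \<in> hikes_alphabet G \<Longrightarrow> z \<in> hikes_alphabet G \<Longrightarrow>
      (y, x) \<notin> parcs D \<Longrightarrow> (z, y) \<notin> parcs D \<Longrightarrow> (z, x) \<notin> parcs D"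
proof -
  let ?S = "hikes_alphabet G" and ?W = "snd (noncommutation_graph G)" and ?E = "parcs D"
  have S: "fst (noncommutation_graph G) = ?S" by (simp add: noncommutation_graph_def)
  \<comment> \<open>Dropping the two conjuncts that place vertices and arcs leaves the conditions on
    loops, pairs and triples.\<close>
  note closure = assms[unfolded is_closure_def Let_def S, THEN conjunct2, THEN conjunct2]
  show irrefl: "(x, x) \<in> ?E" if "x \<in> ?S" for x
    using closure[THEN conjunct1] that by blast
  have both: "(x, y) \<in> ?E \<and> (y, x) \<in> ?E" if "x \<in> ?S" "y \<in> ?S" "x \<noteq> y" "{x, y} \<in> ?W" for x y
    using closure[THEN conjunct2, THEN conjunct1] that by blast
  have one: "(x, y) \<in> ?E \<longleftrightarrow> (y, x) \<notin> ?E" if "x \<in> ?S" "y \<in> ?S" "x \<noteq> y" "{x, y} \<notin> ?W" for x y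
    using closure[THEN conjunct2, THEN conjunct2, THEN conjunct1] that by blast
  have same: "((s, u) \<in> ?E \<and> (t, u) \<in> ?E) \<or> ((u, s) \<in> ?E \<and> (u, t) \<in> ?E)"
    if "s \<in> ?S" "t \<in> ?S" "u \<in> ?S" "s \<noteq> t" "s \<noteq> u" "t \<noteq> u"
      "{s, t} \<in> ?W" "{s, u} \<notin> ?W" "{t, u} \<notin> ?W" for s t u
    using closure[THEN conjunct2, THEN conjunct2, THEN conjunct2, THEN conjunct1] that by blast
  have acyclic: "\<not> ((s, t) \<in> ?E \<and> (t, u) \<in> ?E \<and> (u, s) \<in> ?E)"
    if "s \<in> ?S" "t \<in> ?S" "u \<in> ?S" "s \<noteq> t" "s \<noteq> u" "t \<noteq> u"
      "{s, t} \<notin> ?W" "{s, u} \<notin> ?W" "{t, u} \<notin> ?W" for s t u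
    using closure[THEN conjunct2, THEN conjunct2, THEN conjunct2, THEN conjunct2] that by blast
  show "(x, y) \<in> hikes_independence G \<longleftrightarrow> (y, x) \<notin> ?E \<or> (x, y) \<notin> ?E"
    if "x \<in> ?S" "y \<in> ?S" "x \<noteq> y" for x y
    using both[of x y] one[of x y] noncommutation_graph_edge_iff[of x G y] that by blast
  show "(z, x) \<notin> ?E"
    if S: "x \<in> ?S" "y \<in> ?S" "z \<in> ?S" and L: "(y, x) \<notin> ?E" "(z, y) \<notin> ?E" for x y z
  proof -
    \<comment> \<open>Loops are present and noncommuting pairs carry both arcs, so a missing arc
      joins two distinct commuting cycles and its reverse is present. This yields the path from
      \<open>x\<close> through \<open>y\<close> to \<open>z\<close>.\<close>
    have ne: "x \<noteq> y" "y \<noteq> z" using irrefl S L by blast+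
    hence W: "{x, y} \<notin> ?W" "{y, z} \<notin> ?W" using both S L by blast+
    have xy: "(x, y) \<in> ?E" "(y, z) \<in> ?E" using one S L ne W by blast+
    hence "x \<noteq> z" using L by blast
    moreover have "{z, y} \<notin> ?W" using W(2) by (simp add: insert_commute)
    \<comment> \<open>If \<open>x\<close> and \<open>z\<close> did not commute, the arcs between
      \<open>y\<close> and these two would both enter or both leave \<open>y\<close>, yet one enters
      and the other leaves.\<close>
    ultimately have "{x, z} \<notin> ?W" using same[of x z y] S L ne W by blast
    \<comment> \<open>An arc from \<open>z\<close> to \<open>x\<close> would close the path to a
      directed 3-cycle on pairwise commuting cycles.\<close>
    thus ?thesis using acyclic[of x y z] S ne W xy \<open>x \<noteq> z\<close> by blast
  qed
qed

section \<open>Chains of indices and cliques of commuting cycles\<close>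

theorem theorem5p18:
  fixes G :: "'v pair_pre_digraph"
    and n :: nat
    and h :: "nat \<Rightarrow> ('v \<times> 'v) cyclic_path"
    and Gplus :: "('v \<times> 'v) cyclic_path pair_pre_digraph"
  assumes "pair_digraph G"
    and "connected (with_proj G)"
    and "bij_betw h {1..n} (hikes_alphabet G)"
    and "is_closure (noncommutation_graph G) Gplus"
  shows "Cdet (hike_ring G) n
           (matrix_minus (hike_ring G)
             (one_matrix (hike_ring G))
             (matrix_mult (hike_ring G) n
               (diag_matrix (hike_ring G) (\<lambda>i. hike_gen G (h i)))
               (adjacency_matrix (hike_ring G) h Gplus)))
         = clique_polynomial (hike_ring G) (hike_gen G) (commutation_graph G)"
proof -
  interpret R: ring "hike_ring G" by (rule ring_hike_ring)
  let ?R = "hike_ring G" and ?N = "{1..n}" and ?S = "hikes_alphabet G"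
  define g where "g = (\<lambda>i. hike_gen G (h i))"
  define m where "m = (\<lambda>T. ring_list_prod ?R (map g (filter (\<lambda>i. i \<in> T) [1..<Suc n])))"
  \<comment> \<open>The order transported to indices, with arcs reversed so that
    \<open>\<not> lt j i\<close> is exactly the condition for entry \<open>(i, j)\<close> of the
    adjacency matrix to be 1.\<close>
  define lt where "lt = (\<lambda>i j. (h j, h i) \<notin> parcs Gplus)"
  \<comment> \<open>The chains, as sets of indices.\<close>
  define K where "K = {T. T \<subseteq> ?N \<and> (\<forall>i\<in>T. \<forall>j\<in>T. i \<noteq> j \<longrightarrow> lt i j \<or> lt j i)}"
  have h: "h i \<in> ?S" if "i \<in> ?N" for i
    using assms(3) that by (auto simp: bij_betw_def)
  have inj: "inj_on h ?N" and img: "h ` ?N = ?S"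
    using assms(3) by (auto simp: bij_betw_def)
  have g: "g \<in> ?N \<rightarrow> carrier ?R"
    using h by (auto simp: g_def intro: hike_gen_closed)
  have m: "m T \<in> carrier ?R" for T
    unfolding m_def using g by (intro R.ring_list_prod_closed) auto
  have indep: "(h i, h j) \<in> hikes_independence G \<longleftrightarrow> lt i j \<or> lt j i"
    if "i \<in> ?N" "j \<in> ?N" "i \<noteq> j" for i j
    unfolding lt_def using closure_comparable[OF assms(4) h h] inj_onD[OF inj, of i j] that by blast
  have K_indep: "(h i, h j) \<in> hikes_independence G" if "T \<in> K" "i \<in> T" "j \<in> T" "i \<noteq> j" for T i j
  proof -
    have "i \<in> ?N" "j \<in> ?N" "lt i j \<or> lt j i" using that unfolding K_def by blast+
    thus ?thesis using indep that(4) by blast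
  qed
  \<comment> \<open>The principal minors of the adjacency matrix are the indicator of the
    chains.\<close>
  have det: "leibniz_det T (\<lambda>i j. of_bool ((h i, h j) \<in> parcs Gplus)) = of_bool (T \<in> K)"
    if T: "T \<subseteq> ?N" for T
  proof -
    have hT: "h i \<in> ?S" if "i \<in> T" for i using T h that by blast
    have "leibniz_det T (\<lambda>i j. of_bool (\<not> lt j i)) =
        of_bool (\<forall>i\<in>T. \<forall>j\<in>T. i \<noteq> j \<longrightarrow> lt i j \<or> lt j i)"
    proof (rule leibniz_det_partial_order)
      show "finite T" using T finite_subset by blast
      show "\<not> lt i i" if "i \<in> T" for i
        using closure_irrefl[OF assms(4) hT[OF that]] by (simp add: lt_def)
      show "lt i k" if "i \<in> T" "j \<in> T" "k \<in> T" "lt i j" "lt j k" for i j k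
        using closure_trans[OF assms(4) hT hT hT, of i j k] that by (simp add: lt_def)
    qed
    thus ?thesis using T by (simp add: lt_def K_def)
  qed
  \<comment> \<open>Comparable indices are those of independent cycles, so the bijection
    \<open>h\<close> turns chains into cliques.\<close>
  have cliques: "cliques (commutation_graph G) = (\<lambda>T. h ` T) ` K"
  proof (intro equalityI subsetI)
    fix c assume "c \<in> cliques (commutation_graph G)"
    hence c: "c \<subseteq> ?S" "\<And>x y. x \<in> c \<Longrightarrow> y \<in> c \<Longrightarrow> x \<noteq> y \<Longrightarrow> (x, y) \<in> hikes_independence G"
      by (simp_all add: cliques_def commutation_graph_edge_iff commutation_graph_vertices)
    define T where "T = {i \<in> ?N. h i \<in> c}"
    have "c = h ` T" using c(1) unfolding img[symmetric] T_def by blast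
    moreover have "T \<in> K"
      unfolding K_def
    proof (intro CollectI conjI ballI impI)
      show "T \<subseteq> ?N" by (auto simp: T_def)
      fix i j assume "i \<in> T" "j \<in> T" "i \<noteq> j"
      moreover from this have "h i \<noteq> h j" using inj_onD[OF inj, of i j] unfolding T_def by blast
      ultimately show "lt i j \<or> lt j i"
        using c(2)[of "h i" "h j"] indep[of i j] unfolding T_def by blast
    qed
    ultimately show "c \<in> (\<lambda>T. h ` T) ` K" by blast
  next
    fix c assume "c \<in> (\<lambda>T. h ` T) ` K"
    then obtain T where T: "T \<in> K" "c = h ` T" by blast
    hence "T \<subseteq> ?N" by (simp add: K_def)
    have "(h i, h j) \<in> hikes_independence G" if "i \<in> T" "j \<in> T" "h i \<noteq> h j" for i j
      by (rule K_indep[OF T(1)]) (use that in blast)+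
    moreover have "c \<subseteq> ?S" using T(2) \<open>T \<subseteq> ?N\<close> h by blast
    ultimately show "c \<in> cliques (commutation_graph G)"
      unfolding cliques_def commutation_graph_edge_iff commutation_graph_vertices T(2) by simp
  qed
  \<comment> \<open>The cycles of a clique commute, so its product may be taken in increasing order
    of indices, which is the order produced by the Cayley determinant.\<close>
  have prod: "[((- 1 :: int) ^ card (h ` T))] \<cdot>\<^bsub>?R\<^esub> commuting_prod ?R (hike_gen G) (h ` T) =
      [((- 1 :: int) ^ card T)] \<cdot>\<^bsub>?R\<^esub> m T" if T: "T \<in> K" for T
  proof -
    have TN: "T \<subseteq> ?N" using T by (simp add: K_def)
    hence injT: "inj_on h T" using inj inj_on_subset by blast
    let ?xs = "map h (filter (\<lambda>i. i \<in> T) [1..<Suc n])"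
    have set: "set (filter (\<lambda>i. i \<in> T) [1..<Suc n]) = T" using TN by auto
    have "commuting_prod ?R (hike_gen G) (set ?xs) = ring_list_prod ?R (map (hike_gen G) ?xs)"
    proof (rule R.commuting_prod_eq)
      show "distinct ?xs" using injT set by (simp add: distinct_map)
      show "hike_gen G \<in> set ?xs \<rightarrow> carrier ?R"
        unfolding set_map set using h TN by (blast intro: hike_gen_closed)
      fix x y assume "x \<in> set ?xs" "y \<in> set ?xs" "x \<noteq> y"
      then obtain i j where "i \<in> T" "j \<in> T" "x = h i" "y = h j" "i \<noteq> j"
        unfolding set_map set by blast
      hence "(x, y) \<in> hikes_independence G"
        using K_indep[OF T] by blast
      thus "hike_gen G x \<otimes>\<^bsub>?R\<^esub> hike_gen G y = hike_gen G y \<otimes>\<^bsub>?R\<^esub> hike_gen G x"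
        by (rule hike_gen_commute)
    qed
    moreover have "set ?xs = h ` T" using set by (simp only: set_map)
    ultimately have "commuting_prod ?R (hike_gen G) (h ` T) = m T"
      by (simp only: m_def g_def map_map o_def)
    thus ?thesis using injT by (simp add: card_image)
  qed
  have closed: "[((- 1 :: int) ^ card (h ` T))] \<cdot>\<^bsub>?R\<^esub> commuting_prod ?R (hike_gen G) (h ` T) \<in> carrier ?R"
    if "T \<in> K" for T
    unfolding prod[OF that] using m by (rule R.add.int_pow_closed)
  have K: "K \<subseteq> Pow ?N" by (auto simp: K_def)
  have "Cdet ?R n (matrix_minus ?R (one_matrix ?R)
      (matrix_mult ?R n (diag_matrix ?R g) (adjacency_matrix ?R h Gplus))) =
    (\<Oplus>\<^bsub>?R\<^esub>T\<in>Pow ?N. [((- 1) ^ card T *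
      leibniz_det T (\<lambda>i j. of_bool ((h i, h j) \<in> parcs Gplus)))] \<cdot>\<^bsub>?R\<^esub> m T)"
    unfolding m_def by (rule R.Cdet_one_minus_diag_adjacency[OF g])
  \<comment> \<open>Index sets that are not chains have coefficient 0; for chains the minor is 1 and
    only the sign remains.\<close>
  also have "\<dots> = (\<Oplus>\<^bsub>?R\<^esub>T\<in>K. [((- 1 :: int) ^ card T)] \<cdot>\<^bsub>?R\<^esub> m T)"
    by (rule R.add.finprod_mono_neutral_cong_right) (use K m det in auto)
  also have "\<dots> = (\<Oplus>\<^bsub>?R\<^esub>T\<in>K. [((- 1 :: int) ^ card (h ` T))] \<cdot>\<^bsub>?R\<^esub>
      commuting_prod ?R (hike_gen G) (h ` T))"
    by (rule R.finsum_cong') (use closed prod[symmetric] in blast)+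
  also have "\<dots> = clique_polynomial ?R (hike_gen G) (commutation_graph G)"
    unfolding clique_polynomial_def cliques
  \<comment> \<open>Injectivity of \<open>h\<close> ensures that each clique comes from exactly one
    chain.\<close>
  proof (rule R.finsum_reindex[symmetric])
    show "inj_on (\<lambda>T. h ` T) K"
      by (rule inj_on_subset[OF inj_on_image_Pow[OF inj] K])
  qed (use closed in blast)
  finally show ?thesis unfolding g_def .
qed

end
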